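(* Consider the tree dyadic model with repeated coefficients (RCM), and let $$h=\frac13\Bigl(\alpha-\frac d2\Bigr)-\frac12(\ell_\infty-\ell_{3/2}).$$ Suppose $h\in(0,1)$. Then there exists a unique constant Leray solution $u$. For $s\in(0,1)$, $u$ lies in $C^s$ if and only if $s\le h$. The exponents of its structure function are $$\zeta_p=\min\Bigl\{p;\ \frac p3\Bigl(\alpha-\frac d2\Bigr)+\frac p2(\ell_{3/2}-\ell_{p/2})\Bigr\},\qquad p\ge0.$$ The function $p\mapsto\zeta_p$ on $[0,\infty)$ is continuous, non-decreasing and concave, satisfies $\zeta_0=0$ and $\zeta_3=\min\{3;\alpha-d/2\}$, and has as $p\to\infty$ the oblique asymptote $p\mapsto hp+d-\log_2m$, where $m$ is the multiplicity of the largest $\delta_\omega$ (the number of $\omega\in\Omega$ with $\delta_\omega=\max_{v\in\Omega}\delta_v$).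
   Context: Tree: let $d\ge1$ be an integer, $N=2^d$. $J=\bigcup_{n\ge0}\{1,\dots,N\}^n$ is the set of finite words, $\emptyset$ the empty word, $|j|$ the length of $j$; for $j\neq\emptyset$, $\bar\jmath$ is $j$ with its last letter removed; $\mathcal O_j=\{k\in J:\bar k=j\}$. Model: given $\alpha>0$, $f>0$ and positive coefficients $(d_j)_{j\in J}$ with $d_\emptyset=1$, let $c_j=d_j2^{\alpha|j|}$ and consider $$v_j'(t)=c_jv_{\bar\jmath}^2(t)-\sum_{k\in\mathcal O_j}c_kv_j(t)v_k(t),\qquad j\in J,\ t\ge0,$$ with $v_{\bar\emptyset}(t)\equiv f$. A constant componentwise solution is a family $u=(u_j)_{j\in J}$ of non-negative reals with $c_ju_{\bar\jmath}^2=\sum_{k\in\mathcal O_j}c_ku_ju_k$ for all $j\in J$ (with $u_{\bar\emptyset}=f$). It is Leray if $\sum_ju_j^2<\infty$. RCM: there is a family $\{\delta_\omega:\omega\in\Omega\}$ of positive numbers, $|\Omega|=N$, such that for every $j\in J$ the multiset $\{d_k:k\in\mathcal O_j\}$ equals $\{\delta_\omega:\omega\in\Omega\}$ (with multiplicities). Notation: $\ell_s=\frac1s\log_2\bigl(\frac1N\sum_\omega\delta_\omega^s\bigr)$ for $s\ne0$, $\ell_0=\frac1N\sum_\omega\log_2\delta_\omega$, $\ell_\infty=\lim_{s\to\infty}\ell_s=\log_2\max_\omega\delta_\omega$. For $s\in(0,1)$, $C^s$ is the set of maps $u:J\to\mathbb R$ such that $$\sup_{n\ge1}\Bigl(ns+\frac12dn+\max_{|j|=n}\log_2|u_j|\Bigr)<\infty.$$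 The exponents of the structure function of $u$ are defined by $$\zeta_p=\min\Bigl\{p;\ d-\frac p2d-\limsup_{n\to\infty}\frac1n\log_2\sum_{|j|=n}|u_j|^p\Bigr\},\qquad p\ge0.$$ *)

theory Defs
  imports "HOL-Analysis.Analysis" "HOL-Library.Multiset"
begin

text \<open>Nodes of the tree are words over the alphabet {1, ..., 2^d}, represented as lists with
  the last letter at the end, so that the parent of a nonempty word is given by butlast.\<close>

definition tree :: "nat \<Rightarrow> nat list set" where
  "tree d = lists {1..2 ^ d}"

definition level :: "nat \<Rightarrow> nat \<Rightarrow> nat list set" where
  "level d n = {j \<in> tree d. length j = n}"

text \<open>The root must be excluded explicitly, since butlast [] = [].\<close>

definition offspring :: "nat \<Rightarrow> nat list \<Rightarrow> nat list set" where
  "offspring d j = {k \<in> tree d. k \<noteq> [] \<and> butlast k = j}"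

definition coef :: "real \<Rightarrow> (nat list \<Rightarrow> real) \<Rightarrow> nat list \<Rightarrow> real" where
  "coef \<alpha> dc j = dc j * 2 powr (\<alpha> * real (length j))"

text \<open>The value at the parent node, the parent of the root carrying the forcing f.\<close>

definition parent_val :: "real \<Rightarrow> (nat list \<Rightarrow> real) \<Rightarrow> nat list \<Rightarrow> real" where
  "parent_val f u j = (if j = [] then f else u (butlast j))"

text \<open>Families indexed by the tree are extensional functions, so that equality of functions
  is equality of families (this is what makes unique existence meaningful).\<close>

definition constant_solution ::
    "nat \<Rightarrow> real \<Rightarrow> real \<Rightarrow> (nat list \<Rightarrow> real) \<Rightarrow> (nat list \<Rightarrow> real) \<Rightarrow> bool" where
  "constant_solution d \<alpha> f dc u \<longleftrightarrow>
     u \<in> tree d \<rightarrow>\<^sub>E {0..} \<and>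
     (\<forall>j \<in> tree d. coef \<alpha> dc j * (parent_val f u j)\<^sup>2
        = (\<Sum>k \<in> offspring d j. coef \<alpha> dc k * u j * u k))"

definition constant_Leray_solution ::
    "nat \<Rightarrow> real \<Rightarrow> real \<Rightarrow> (nat list \<Rightarrow> real) \<Rightarrow> (nat list \<Rightarrow> real) \<Rightarrow> bool" where
  "constant_Leray_solution d \<alpha> f dc u \<longleftrightarrow>
     constant_solution d \<alpha> f dc u \<and> (\<lambda>j. (u j)\<^sup>2) summable_on tree d"

definition repeated_coefficients ::
    "nat \<Rightarrow> (nat list \<Rightarrow> real) \<Rightarrow> 'w set \<Rightarrow> ('w \<Rightarrow> real) \<Rightarrow> bool" where
  "repeated_coefficients d dc \<Omega> \<delta> \<longleftrightarrow>
     finite \<Omega> \<and> card \<Omega> = 2 ^ d \<and> (\<forall>\<omega> \<in> \<Omega>. \<delta> \<omega> > 0) \<and>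
     (\<forall>j \<in> tree d.
        image_mset dc (mset_set (offspring d j)) = image_mset \<delta> (mset_set \<Omega>))"

definition ell :: "'w set \<Rightarrow> ('w \<Rightarrow> real) \<Rightarrow> real \<Rightarrow> real" where
  "ell \<Omega> \<delta> s =
     (if s = 0 then (1 / real (card \<Omega>)) * (\<Sum>\<omega> \<in> \<Omega>. log 2 (\<delta> \<omega>))
      else (1 / s) * log 2 ((1 / real (card \<Omega>)) * (\<Sum>\<omega> \<in> \<Omega>. \<delta> \<omega> powr s)))"

definition ell_inf :: "'w set \<Rightarrow> ('w \<Rightarrow> real) \<Rightarrow> real" where
  "ell_inf \<Omega> \<delta> = log 2 (Max (\<delta> ` \<Omega>))"

lemma ell_tendsto_ell_inf:
  fixes \<delta> :: "'w \<Rightarrow> real"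
  assumes fin: "finite \<Omega>" and ne: "\<Omega> \<noteq> {}" and pos: "\<And>\<omega>. \<omega> \<in> \<Omega> \<Longrightarrow> \<delta> \<omega> > 0"
  shows "(ell \<Omega> \<delta> \<longlongrightarrow> ell_inf \<Omega> \<delta>) at_top"
proof -
  define M where "M = Max (\<delta> ` \<Omega>)"
  define N where "N = real (card \<Omega>)"
  have N: "N > 0" using fin ne by (simp add: N_def card_gt_0_iff)
  have "M \<in> \<delta> ` \<Omega>" unfolding M_def using fin ne by (intro Max_in) auto
  then obtain w where w: "w \<in> \<Omega>" "\<delta> w = M" by blast
  have M: "M > 0" using pos[OF w(1)] w(2) by simp
  have le: "\<delta> v \<le> M" if "v \<in> \<Omega>" for v
    using fin that by (simp add: M_def)
  have bounds: "log 2 M - log 2 N / s \<le> ell \<Omega> \<delta> s \<and> ell \<Omega> \<delta> s \<le> log 2 M"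
    if s: "s > 0" for s :: real
  proof -
    let ?S = "\<Sum>v \<in> \<Omega>. \<delta> v powr s"
    have lo: "M powr s \<le> ?S"
      using member_le_sum[of w \<Omega> "\<lambda>v. \<delta> v powr s"] fin w by simp
    have "?S \<le> (\<Sum>v \<in> \<Omega>. M powr s)"
      using s le pos by (intro sum_mono powr_mono2) (auto intro: less_imp_le)
    then have hi: "?S \<le> N * M powr s" by (simp add: N_def)
    have Mp: "M powr s > 0" using M by simp
    have Sp: "?S > 0" using lo Mp by linarith
    have e: "ell \<Omega> \<delta> s = (log 2 ?S - log 2 N) / s"
      using s N Sp by (simp add: ell_def N_def[symmetric] log_divide)
    have "log 2 (M powr s) \<le> log 2 ?S" using lo Mp Sp by simp
    then have 1: "s * log 2 M \<le> log 2 ?S" using M by (simp add: log_powr)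
    have "log 2 ?S \<le> log 2 (N * M powr s)" using hi Mp Sp N by simp
    then have 2: "log 2 ?S \<le> log 2 N + s * log 2 M"
      using M N by (simp add: log_mult log_powr)
    show ?thesis unfolding e using 1 2 s by (simp add: field_simps)
  qed
  have lim: "((\<lambda>s. log 2 M - log 2 N / s) \<longlongrightarrow> log 2 M - 0) at_top"
    by (intro tendsto_diff tendsto_const tendsto_divide_0[OF tendsto_const]
        filterlim_at_top_imp_at_infinity filterlim_ident)
  show ?thesis unfolding ell_inf_def M_def[symmetric]
  proof (rule tendsto_sandwich)
    show "\<forall>\<^sub>F s in at_top. log 2 M - log 2 N / s \<le> ell \<Omega> \<delta> s"
      using eventually_gt_at_top[of "0::real"] by eventually_elim (use bounds in blast)
    show "\<forall>\<^sub>F s in at_top. ell \<Omega> \<delta> s \<le> log 2 M"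
      using eventually_gt_at_top[of "0::real"] by eventually_elim (use bounds in blast)
  qed (use lim in simp_all)
qed

text \<open>Binary logarithm of a non-negative real, with value minus infinity at 0
  (the library has log 2 0 = 0).\<close>

definition elog2 :: "real \<Rightarrow> ereal" where
  "elog2 x = (if x = 0 then -\<infinity> else ereal (log 2 x))"

definition holder_class :: "nat \<Rightarrow> real \<Rightarrow> (nat list \<Rightarrow> real) set" where
  "holder_class d s = {u \<in> tree d \<rightarrow>\<^sub>E UNIV.
     (SUP n \<in> {1..}. ereal (real n * s + (1 / 2) * real d * real n)
        + Max ((\<lambda>j. elog2 \<bar>u j\<bar>) ` level d n)) < \<infinity>}"

text \<open>A priori the exponents are extended reals. The library convention 0 powr 0 = 0 is
  immaterial for constant solutions with positive forcing, which are strictly positive on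
  the tree.\<close>

definition structure_exponent :: "nat \<Rightarrow> (nat list \<Rightarrow> real) \<Rightarrow> real \<Rightarrow> ereal" where
  "structure_exponent d u p =
     min (ereal p)
       (ereal (real d - p / 2 * real d)
        - limsup (\<lambda>n. ereal (1 / real n) * elog2 (\<Sum>j \<in> level d n. \<bar>u j\<bar> powr p)))"

end

theory Submission
  imports Defs "HOL-Real_Asymp.Real_Asymp"
begin

text \<open>The recursion \<open>u\<^sub>k = \<lambda> * sqrt d\<^sub>k * u\<^sub>j\<close> for \<open>k\<close> an offspring of \<open>j\<close>, with
  \<open>\<lambda>\<^sup>3 * 2\<^sup>\<alpha> * (\<Sum>\<omega>. \<delta>\<^sub>\<omega> powr (3/2)) = 1\<close>, solves the system; all its level sums of powers
  are geometric, and the exponents reduce to a log-sum-exp function. For uniqueness, the ratio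
  \<open>w\<close> of a solution to this one satisfies: \<open>w\<^sup>2\<close> at the parent of \<open>j\<close> is \<open>w\<^sub>j\<close> times a weighted
  mean of \<open>w\<close> over the offspring of \<open>j\<close>. Logarithmically this is a linear recursion with
  characteristic roots 1 and -2; the second root makes a deviation from 1 grow doubly
  exponentially along a suitable branch, whereas the self-similar solution decays only
  exponentially, so square summability fails.\<close>

section \<open>Real-analysis preliminaries: log-sum-exp functions and weighted means\<close>

text \<open>This is Hoelder's inequality with exponents \<open>1 / (1 - t)\<close> and
  \<open>1 / t\<close>, after taking logarithms. Normalising both families by their sums
  \<open>A\<close> and \<open>B\<close> reduces it to Young's inequality for each term.\<close>

lemma convex_on_log_sum_powr:
  fixes b :: "'w \<Rightarrow> real"
  assumes fin: "finite W" and ne: "W \<noteq> {}" and pos: "\<And>w. w \<in> W \<Longrightarrow> b w > 0"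
  shows "convex_on UNIV (\<lambda>p. log 2 (\<Sum>w\<in>W. b w powr p))"
proof (rule convex_onI)
  fix t x y :: real
  assume t: "t > 0" "t < 1"
  define A where "A = (\<Sum>w\<in>W. b w powr x)"
  define B where "B = (\<Sum>w\<in>W. b w powr y)"
  define z where "z = (1 - t) *\<^sub>R x + t *\<^sub>R y"
  have AB: "A > 0" "B > 0"
    unfolding A_def B_def using fin ne pos by (auto intro!: sum_pos simp: less_imp_neq[symmetric])
  have Z: "(\<Sum>w\<in>W. b w powr z) > 0"
    using fin ne pos by (auto intro!: sum_pos simp: less_imp_neq[symmetric])
  have "(\<Sum>w\<in>W. b w powr z) / (A powr (1 - t) * B powr t)
      = (\<Sum>w\<in>W. (b w powr x / A) powr (1 - t) * (b w powr y / B) powr t)"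
    unfolding sum_divide_distrib
  proof (rule sum.cong)
    fix w assume "w \<in> W"
    then have "b w > 0" using pos by blast
    then show "b w powr z / (A powr (1 - t) * B powr t)
        = (b w powr x / A) powr (1 - t) * (b w powr y / B) powr t"
      using AB by (simp add: z_def powr_divide powr_powr powr_add mult.commute)
  qed simp
  also have "\<dots> \<le> (\<Sum>w\<in>W. (1 - t) * (b w powr x / A) + t * (b w powr y / B))"
    using t AB pos by (intro sum_mono Youngs_inequality_0) (auto simp: less_imp_neq[symmetric])
  also have "\<dots> = (1 - t) * (A / A) + t * (B / B)"
    by (simp add: sum.distrib A_def B_def flip: sum_distrib_left sum_divide_distrib)
  also have "\<dots> = 1" using AB by simp
  finally have "(\<Sum>w\<in>W. b w powr z) \<le> A powr (1 - t) * B powr t"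
    using AB by (simp add: divide_le_eq)
  then have "log 2 (\<Sum>w\<in>W. b w powr z) \<le> log 2 (A powr (1 - t) * B powr t)"
    using Z AB by simp
  also have "\<dots> = (1 - t) * log 2 A + t * log 2 B"
    using AB by (simp add: log_mult log_powr)
  finally show "log 2 (\<Sum>w\<in>W. b w powr ((1 - t) *\<^sub>R x + t *\<^sub>R y))
      \<le> (1 - t) * log 2 (\<Sum>w\<in>W. b w powr x) + t * log 2 (\<Sum>w\<in>W. b w powr y)"
    by (simp add: z_def A_def B_def)
qed simp

lemma concave_on_min:
  assumes "concave_on S f" "concave_on S g"
  shows "concave_on S (\<lambda>x. min (f x) (g x))"
  unfolding concave_on_iff
proof (intro conjI ballI allI impI)
  show "convex S" using assms(1) by (rule concave_on_imp_convex)
  fix x y and u v :: real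
  assume *: "x \<in> S" "y \<in> S" "0 \<le> u" "0 \<le> v" "u + v = 1"
  have "u * min (f x) (g x) + v * min (f y) (g y) \<le> u * f x + v * f y"
    "u * min (f x) (g x) + v * min (f y) (g y) \<le> u * g x + v * g y"
    using * by (auto intro!: add_mono mult_left_mono)
  moreover have "u * f x + v * f y \<le> f (u *\<^sub>R x + v *\<^sub>R y)"
    "u * g x + v * g y \<le> g (u *\<^sub>R x + v *\<^sub>R y)"
    using assms * by (auto simp: concave_on_iff)
  ultimately show "u * min (f x) (g x) + v * min (f y) (g y)
      \<le> min (f (u *\<^sub>R x + v *\<^sub>R y)) (g (u *\<^sub>R x + v *\<^sub>R y))"
    by linarith
qed

text \<open>After division by \<open>M powr p\<close>, every term with \<open>b w < M\<close> decays
  to 0 and every term with \<open>b w = M\<close> equals 1. The normalised sum therefore tends to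
  the number of maximisers.\<close>

lemma log_sum_powr_asymptote:
  fixes b :: "'w \<Rightarrow> real"
  assumes fin: "finite W" and ne: "W \<noteq> {}" and pos: "\<And>w. w \<in> W \<Longrightarrow> b w > 0"
  defines "M \<equiv> Max (b ` W)"
  shows "((\<lambda>p. log 2 (\<Sum>w\<in>W. b w powr p) - p * log 2 M)
           \<longlongrightarrow> log 2 (real (card {w \<in> W. b w = M}))) at_top"
proof -
  have "M \<in> b ` W" unfolding M_def using fin ne by (intro Max_in) auto
  then obtain w0 where w0: "w0 \<in> W" "b w0 = M" by auto
  then have M: "M > 0" using pos by auto
  have le: "b w \<le> M" if "w \<in> W" for w using that fin by (simp add: M_def)
  have lim: "((\<lambda>p. (b w / M) powr p) \<longlongrightarrow> (if b w = M then 1 else 0)) at_top"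
    if w: "w \<in> W" for w
  proof (cases "b w = M")
    case False
    then have c: "0 < b w / M" "b w / M < 1" using w M le[OF w] pos[OF w] by auto
    then have "ln (b w / M) < 0" by (rule ln_less_zero)
    then have "((\<lambda>p. exp (p * ln (b w / M))) \<longlongrightarrow> 0) at_top" by real_asymp
    then show ?thesis using False c M pos[OF w] by (simp add: powr_def)
  qed (use M in simp)
  have "((\<lambda>p. \<Sum>w\<in>W. (b w / M) powr p) \<longlongrightarrow> (\<Sum>w\<in>W. if b w = M then 1 else 0)) at_top"
    by (intro tendsto_sum lim)
  also have "(\<Sum>w\<in>W. if b w = M then 1 else 0) = real (card {w \<in> W. b w = M})"
    using fin by (simp add: sum.If_cases Int_def)
  finally have *: "((\<lambda>p. \<Sum>w\<in>W. (b w / M) powr p) \<longlongrightarrow> real (card {w \<in> W. b w = M})) at_top" .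
  have c: "card {w \<in> W. b w = M} > 0" using w0 fin by (auto simp: card_gt_0_iff)
  have "((\<lambda>p. log 2 (\<Sum>w\<in>W. (b w / M) powr p)) \<longlongrightarrow> log 2 (real (card {w \<in> W. b w = M}))) at_top"
    using c by (intro tendsto_intros *) auto
  moreover have "log 2 (\<Sum>w\<in>W. (b w / M) powr p)
      = log 2 (\<Sum>w\<in>W. b w powr p) - p * log 2 M" for p
  proof -
    have "(\<Sum>w\<in>W. (b w / M) powr p) = (\<Sum>w\<in>W. b w powr p) / M powr p"
      using M pos by (auto simp: sum_divide_distrib powr_divide less_imp_le intro!: sum.cong)
    moreover have "(\<Sum>w\<in>W. b w powr p) > 0"
      using fin ne pos by (auto intro!: sum_pos simp: less_imp_neq[symmetric])
    ultimately show ?thesis using M by (simp add: log_divide log_powr)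
  qed
  ultimately show ?thesis by simp
qed

text \<open>\<open>m\<close> is the mean of \<open>w\<close> with weights \<open>q\<close>, written
  without division. A mean cannot lie strictly below, or strictly above, all the values it
  averages.\<close>

lemma weighted_mean_bounds:
  fixes q w :: "'a \<Rightarrow> real"
  assumes "finite A" "A \<noteq> {}" "\<And>k. k \<in> A \<Longrightarrow> q k > 0"
    and eq: "m * sum q A = (\<Sum>k\<in>A. q k * w k)"
  shows "\<exists>k\<in>A. w k \<le> m" "\<exists>k\<in>A. m \<le> w k"
proof -
  have eq': "(\<Sum>k\<in>A. q k * m) = (\<Sum>k\<in>A. q k * w k)"
    using eq by (simp add: sum_distrib_left mult.commute)
  show "\<exists>k\<in>A. w k \<le> m"
  proof (rule ccontr)
    assume "\<not> ?thesis"
    then have "(\<Sum>k\<in>A. q k * m) < (\<Sum>k\<in>A. q k * w k)"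
      using assms by (intro sum_strict_mono) (auto simp: not_le)
    then show False using eq' by simp
  qed
  show "\<exists>k\<in>A. m \<le> w k"
  proof (rule ccontr)
    assume "\<not> ?thesis"
    then have "(\<Sum>k\<in>A. q k * w k) < (\<Sum>k\<in>A. q k * m)"
      using assms by (intro sum_strict_mono) (auto simp: not_le)
    then show False using eq' by simp
  qed
qed

section \<open>Words, offspring and levels of the tree\<close>

lemma Nil_in_tree: "[] \<in> tree d"
  by (simp add: tree_def)

lemma snoc_in_tree_iff: "j @ [a] \<in> tree d \<longleftrightarrow> j \<in> tree d \<and> a \<in> {1..2 ^ d}"
  by (auto simp: tree_def)

lemma tree_induct [consumes 1, case_names Nil snoc]:
  assumes "j \<in> tree d" and "P []"
    and "\<And>j a. j \<in> tree d \<Longrightarrow> j @ [a] \<in> offspring d j \<Longrightarrow> P j \<Longrightarrow> P (j @ [a])"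
  shows "P j"
  using assms(1)
proof (induction j rule: rev_induct)
  case (snoc a j)
  then show ?case using assms(3)[of j a] by (auto simp: snoc_in_tree_iff offspring_def)
qed (rule assms(2))

lemma tree_cases [consumes 1, case_names Nil offspring]:
  assumes "j \<in> tree d"
  obtains "j = []" | i where "i \<in> tree d" "j \<in> offspring d i"
  using assms
  by (cases j rule: rev_cases) (auto simp: snoc_in_tree_iff offspring_def)

lemma offspring_eq: "j \<in> tree d \<Longrightarrow> offspring d j = (\<lambda>a. j @ [a]) ` {1..2 ^ d}"
  unfolding offspring_def
  by (auto simp: snoc_in_tree_iff image_iff) (metis append_butlast_last_id snoc_in_tree_iff
      atLeastAtMost_iff One_nat_def)

lemma offspringD:
  assumes "k \<in> offspring d j"
  shows "k \<in> tree d" "k \<noteq> []" "butlast k = j" "length k = Suc (length j)"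
  using assms by (auto simp: offspring_def simp flip: length_greater_0_conv)

lemma finite_offspring: "j \<in> tree d \<Longrightarrow> finite (offspring d j)"
  by (simp add: offspring_eq)

lemma offspring_nonempty: "j \<in> tree d \<Longrightarrow> offspring d j \<noteq> {}"
  by (simp add: offspring_eq)

lemma parent_val_offspring: "k \<in> offspring d j \<Longrightarrow> parent_val f u k = u j"
  by (simp add: parent_val_def offspringD)

lemma level_0: "level d 0 = {[]}"
  by (auto simp: level_def Nil_in_tree)

lemma level_Suc: "level d (Suc n) = (\<Union>j\<in>level d n. offspring d j)"
proof (intro subset_antisym subsetI)
  fix k assume k: "k \<in> level d (Suc n)"
  then obtain j a where "k = j @ [a]"
    by (cases k rule: rev_cases) (auto simp: level_def)
  with k show "k \<in> (\<Union>j\<in>level d n. offspring d j)"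
    by (auto simp: level_def offspring_def snoc_in_tree_iff)
next
  fix k assume "k \<in> (\<Union>j\<in>level d n. offspring d j)"
  then show "k \<in> level d (Suc n)"
    using offspringD by (fastforce simp: level_def)
qed

lemma level_in_tree: "j \<in> level d n \<Longrightarrow> j \<in> tree d"
  by (simp add: level_def)

lemma finite_level: "finite (level d n)"
proof (induction n)
  case (Suc n)
  then show ?case using level_in_tree finite_offspring by (auto simp: level_Suc)
qed (simp add: level_0)

lemma sum_level_Suc:
  "(\<Sum>k\<in>level d (Suc n). F k) = (\<Sum>j\<in>level d n. \<Sum>k\<in>offspring d j. F k)"
  unfolding level_Suc
proof (rule sum.UNION_disjoint)
  show "\<forall>i\<in>level d n. finite (offspring d i)" using level_in_tree finite_offspring by blast
qed (auto simp: finite_level offspring_def)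

section \<open>Consequences of repeated coefficients\<close>

locale rcm =
  fixes d :: nat and \<alpha> f :: real and dc :: "nat list \<Rightarrow> real"
    and \<Omega> :: "'w set" and \<delta> :: "'w \<Rightarrow> real"
  assumes f_pos: "f > 0"
    and dc_pos: "j \<in> tree d \<Longrightarrow> dc j > 0" and dc_Nil: "dc [] = 1"
    and rc: "repeated_coefficients d dc \<Omega> \<delta>"
begin

lemma finite_\<Omega>: "finite \<Omega>" and card_\<Omega>: "card \<Omega> = 2 ^ d"
  and \<delta>_pos: "\<omega> \<in> \<Omega> \<Longrightarrow> \<delta> \<omega> > 0"
  using rc by (auto simp: repeated_coefficients_def)

lemma \<Omega>_nonempty: "\<Omega> \<noteq> {}"
  using card_\<Omega> by auto

lemma mset_offspring:
  "j \<in> tree d \<Longrightarrow> image_mset dc (mset_set (offspring d j)) = image_mset \<delta> (mset_set \<Omega>)"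
  using rc by (auto simp: repeated_coefficients_def)

text \<open>Equality of multisets makes such a sum independent of the node \<open>j\<close>. This is
  what turns all level sums below into geometric sequences.\<close>

lemma sum_offspring:
  fixes F :: "real \<Rightarrow> real"
  assumes "j \<in> tree d"
  shows "(\<Sum>k\<in>offspring d j. F (dc k)) = (\<Sum>\<omega>\<in>\<Omega>. F (\<delta> \<omega>))"
proof -
  have "(\<Sum>k\<in>offspring d j. F (dc k)) = \<Sum>\<^sub># (image_mset F (image_mset dc (mset_set (offspring d j))))"
    by (simp add: sum_unfold_sum_mset multiset.map_comp comp_def)
  then show ?thesis
    unfolding mset_offspring[OF assms]
    by (simp add: sum_unfold_sum_mset multiset.map_comp comp_def)
qed

lemma dc_image_offspring:
  assumes "j \<in> tree d"
  shows "dc ` offspring d j = \<delta> ` \<Omega>"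
  using arg_cong[OF mset_offspring[OF assms], of set_mset] finite_\<Omega> finite_offspring[OF assms]
  by simp

section \<open>The self-similar solution\<close>

definition S :: real where "S = (\<Sum>\<omega>\<in>\<Omega>. \<delta> \<omega> powr (3 / 2))"

text \<open>The cube root arises because the equation at \<open>j\<close> carries the factor
  \<open>rate (dc j)\<close> twice and a factor \<open>rate (dc k)\<close> once.\<close>

definition lam :: real where "lam = (2 powr \<alpha> * S) powr (- (1 / 3))"

definition rate :: "real \<Rightarrow> real" where "rate x = lam * x powr (1 / 2)"

abbreviation \<rho> :: "'w \<Rightarrow> real" where "\<rho> \<omega> \<equiv> rate (\<delta> \<omega>)"

text \<open>The words \<open>take (Suc i) j\<close> are the nonempty prefixes of \<open>j\<close>,
  so one rate is collected per edge on the path from the root. The factor \<open>f * lam\<close> is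
  the root value, where \<open>dc [] = 1\<close>. The restriction to the tree makes the family
  extensional.\<close>

definition self_similar :: "nat list \<Rightarrow> real" where
  "self_similar = (\<lambda>j\<in>tree d. f * lam * (\<Prod>i<length j. rate (dc (take (Suc i) j))))"

lemma S_pos: "S > 0"
  unfolding S_def using finite_\<Omega> \<Omega>_nonempty \<delta>_pos
  by (intro sum_pos) (auto simp: less_imp_neq[symmetric])

lemma lam_pos: "lam > 0"
  using S_pos by (simp add: lam_def)

lemma lam_cube: "lam ^ 3 * (2 powr \<alpha> * S) = 1"
proof -
  have "lam ^ 3 = (2 powr \<alpha> * S) powr (-1)"
    using S_pos by (simp add: lam_def powr_powr flip: powr_realpow)
  then show ?thesis using S_pos by (simp add: powr_minus field_simps)
qed

lemma rate_pos: "x > 0 \<Longrightarrow> rate x > 0"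
  using lam_pos by (simp add: rate_def)

lemma rate_less_iff: "x > 0 \<Longrightarrow> y > 0 \<Longrightarrow> rate x < rate y \<longleftrightarrow> x < y"
  using lam_pos by (simp add: rate_def powr_less_cancel_iff) (metis less_eq_real_def linorder_not_le
      powr_less_mono2 powr_mono2 half_gt_zero zero_less_one)

lemma rate_dc_image_offspring: "j \<in> tree d \<Longrightarrow> (\<lambda>k. rate (dc k)) ` offspring d j = \<rho> ` \<Omega>"
  using dc_image_offspring by (metis image_image)

lemma self_similar_Nil: "self_similar [] = f * lam"
  by (simp add: self_similar_def Nil_in_tree)

lemma self_similar_offspring:
  assumes "j \<in> tree d" "k \<in> offspring d j"
  shows "self_similar k = rate (dc k) * self_similar j"
proof -
  obtain a where k: "k = j @ [a]" using assms offspring_eq by auto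
  have "(\<Prod>i<length j. rate (dc (take (Suc i) k))) = (\<Prod>i<length j. rate (dc (take (Suc i) j)))"
    by (intro prod.cong) (auto simp: k)
  then show ?thesis
    using assms offspringD(1)[OF assms(2)] by (simp add: self_similar_def k)
qed

text \<open>With \<open>dc [] = 1\<close> the root has rate \<open>lam\<close> and fits the same
  recursion, its parent value being \<open>f\<close>. Later arguments can then treat all nodes
  alike.\<close>

lemma self_similar_rec:
  assumes "j \<in> tree d"
  shows "self_similar j = rate (dc j) * parent_val f self_similar j"
  using assms
proof (cases rule: tree_cases)
  case Nil
  then show ?thesis by (simp add: self_similar_Nil parent_val_def dc_Nil rate_def)
next
  case (offspring i)
  then show ?thesis by (simp add: self_similar_offspring parent_val_offspring)
qed

lemma self_similar_pos: "j \<in> tree d \<Longrightarrow> self_similar j > 0"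
proof (induction rule: tree_induct)
  case Nil
  then show ?case using f_pos lam_pos by (simp add: self_similar_Nil)
next
  case (snoc j a)
  then show ?case
    using dc_pos rate_pos offspringD(1) by (simp add: self_similar_offspring)
qed

lemma coef_pos: "j \<in> tree d \<Longrightarrow> coef \<alpha> dc j > 0"
  using dc_pos by (simp add: coef_def)

text \<open>Each summand contains \<open>dc k\<close> to the power \<open>1 + 1/2\<close>, and these
  powers add up to \<open>S\<close>. Together with \<open>lam ^ 2 * dc j\<close> from the squared
  rate, one factor \<open>lam ^ 3 * 2 powr \<alpha> * S = 1\<close> splits off.\<close>

lemma sum_coef_rate:
  assumes "j \<in> tree d"
  shows "rate (dc j) ^ 2 * (\<Sum>k\<in>offspring d j. coef \<alpha> dc k * rate (dc k)) = coef \<alpha> dc j"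
proof -
  have "(\<Sum>k\<in>offspring d j. coef \<alpha> dc k * rate (dc k))
      = (\<Sum>k\<in>offspring d j. 2 powr (\<alpha> * real (Suc (length j))) * lam * dc k powr (3/2))"
  proof (rule sum.cong)
    fix k assume k: "k \<in> offspring d j"
    have "dc k powr (3/2) = dc k powr (1 + 1/2)" by simp
    also have "\<dots> = dc k * dc k powr (1/2)"
      unfolding powr_add using dc_pos[OF offspringD(1)[OF k]] by simp
    finally show "coef \<alpha> dc k * rate (dc k)
        = 2 powr (\<alpha> * real (Suc (length j))) * lam * dc k powr (3/2)"
      using offspringD[OF k] by (simp add: coef_def rate_def)
  qed simp
  also have "\<dots> = 2 powr (\<alpha> * real (length j)) * 2 powr \<alpha> * lam * S"
    using sum_offspring[OF assms, of "\<lambda>x. x powr (3/2)"]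
    by (simp add: S_def powr_add distrib_left mult_ac flip: sum_distrib_left sum_distrib_right)
  finally have 1: "(\<Sum>k\<in>offspring d j. coef \<alpha> dc k * rate (dc k))
     = 2 powr (\<alpha> * real (length j)) * 2 powr \<alpha> * lam * S" .
  have 2: "rate (dc j) ^ 2 = lam ^ 2 * dc j"
    using dc_pos[OF assms] by (simp add: rate_def power_mult_distrib powr_powr flip: powr_realpow)
  have "rate (dc j) ^ 2 * (\<Sum>k\<in>offspring d j. coef \<alpha> dc k * rate (dc k))
      = coef \<alpha> dc j * (lam ^ 3 * (2 powr \<alpha> * S))"
    unfolding 1 2 by (simp add: coef_def power2_eq_square power3_eq_cube)
  then show ?thesis by (simp add: lam_cube)
qed

text \<open>The right-hand side is kept as a square times the total weight of the offspring, because
  those weights are the ones that reappear when another solution is divided by this one.\<close>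

lemma self_similar_balance:
  assumes "j \<in> tree d"
  shows "coef \<alpha> dc j * (parent_val f self_similar j)\<^sup>2
    = (self_similar j)\<^sup>2 * (\<Sum>k\<in>offspring d j. coef \<alpha> dc k * rate (dc k))"
proof -
  let ?Q = "\<Sum>k\<in>offspring d j. coef \<alpha> dc k * rate (dc k)"
  have "(self_similar j)\<^sup>2 * ?Q = (rate (dc j))\<^sup>2 * ?Q * (parent_val f self_similar j)\<^sup>2"
    by (simp add: self_similar_rec[OF assms] power_mult_distrib mult_ac)
  then show ?thesis by (simp add: sum_coef_rate[OF assms])
qed

lemma constant_solution_self_similar: "constant_solution d \<alpha> f dc self_similar"
  unfolding constant_solution_def
proof (intro conjI ballI)
  show "self_similar \<in> tree d \<rightarrow>\<^sub>E {0..}"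
    using self_similar_pos by (auto simp: less_imp_le self_similar_def)
  fix j assume j: "j \<in> tree d"
  have "(\<Sum>k\<in>offspring d j. coef \<alpha> dc k * self_similar j * self_similar k)
      = (\<Sum>k\<in>offspring d j. (self_similar j)\<^sup>2 * (coef \<alpha> dc k * rate (dc k)))"
    using j by (intro sum.cong) (auto simp: self_similar_offspring power2_eq_square)
  then show "coef \<alpha> dc j * (parent_val f self_similar j)\<^sup>2
      = (\<Sum>k\<in>offspring d j. coef \<alpha> dc k * self_similar j * self_similar k)"
    by (simp add: self_similar_balance[OF j] sum_distrib_left)
qed

section \<open>Level sums, extremal growth and the Hoelder class\<close>

lemma sum_level_self_similar:
  "(\<Sum>j\<in>level d n. self_similar j powr p) = (f * lam) powr p * (\<Sum>\<omega>\<in>\<Omega>. \<rho> \<omega> powr p) ^ n"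
proof (induction n)
  case 0
  then show ?case by (simp add: level_0 self_similar_Nil)
next
  case (Suc n)
  have "(\<Sum>k\<in>offspring d j. self_similar k powr p)
      = (\<Sum>\<omega>\<in>\<Omega>. \<rho> \<omega> powr p) * self_similar j powr p" if "j \<in> level d n" for j
  proof -
    have j: "j \<in> tree d" using that by (simp add: level_def)
    have "(\<Sum>k\<in>offspring d j. self_similar k powr p)
        = (\<Sum>k\<in>offspring d j. rate (dc k) powr p * self_similar j powr p)"
    proof (rule sum.cong)
      fix k assume k: "k \<in> offspring d j"
      have "dc k > 0" using dc_pos offspringD(1)[OF k] .
      then show "self_similar k powr p = rate (dc k) powr p * self_similar j powr p"
        using self_similar_offspring[OF j k] rate_pos self_similar_pos[OF j]
        by (simp add: powr_mult less_imp_le)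
    qed simp
    then show ?thesis
      using sum_offspring[OF j, of "\<lambda>x. rate x powr p"] by (simp flip: sum_distrib_right)
  qed
  then have "(\<Sum>k\<in>level d (Suc n). self_similar k powr p)
      = (\<Sum>j\<in>level d n. (\<Sum>\<omega>\<in>\<Omega>. \<rho> \<omega> powr p) * self_similar j powr p)"
    by (simp add: sum_level_Suc)
  also have "\<dots> = (\<Sum>\<omega>\<in>\<Omega>. \<rho> \<omega> powr p) * (\<Sum>j\<in>level d n. self_similar j powr p)"
    by (simp add: sum_distrib_left)
  finally show ?case by (simp add: Suc.IH)
qed

lemma \<rho>_pos: "\<omega> \<in> \<Omega> \<Longrightarrow> \<rho> \<omega> > 0"
  using \<delta>_pos rate_pos by blast

lemma sum_\<rho>_pos: "(\<Sum>\<omega>\<in>\<Omega>. \<rho> \<omega> powr p) > 0"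
  using finite_\<Omega> \<Omega>_nonempty \<rho>_pos by (intro sum_pos) (auto simp: less_imp_neq[symmetric])

text \<open>The upper bound serves the Hoelder exponent. The lower one says that the decay is at
  most exponential, which is needed for uniqueness.\<close>

lemma self_similar_bounds:
  "j \<in> tree d \<Longrightarrow> f * lam * Min (\<rho> ` \<Omega>) ^ length j \<le> self_similar j
     \<and> self_similar j \<le> f * lam * Max (\<rho> ` \<Omega>) ^ length j"
proof (induction rule: tree_induct)
  case Nil
  then show ?case by (simp add: self_similar_Nil)
next
  case (snoc j a)
  let ?k = "j @ [a]"
  have "rate (dc ?k) \<in> \<rho> ` \<Omega>"
    using rate_dc_image_offspring[OF snoc(1)] snoc(2) by blast
  then have *: "Min (\<rho> ` \<Omega>) \<le> rate (dc ?k)" "rate (dc ?k) \<le> Max (\<rho> ` \<Omega>)"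
    using finite_\<Omega> by auto
  have m: "Min (\<rho> ` \<Omega>) > 0" using finite_\<Omega> \<Omega>_nonempty \<rho>_pos by auto
  have r: "rate (dc ?k) > 0" using *(1) m by linarith
  have "Min (\<rho> ` \<Omega>) * (f * lam * Min (\<rho> ` \<Omega>) ^ length j) \<le> rate (dc ?k) * self_similar j"
    using * m r snoc.IH f_pos lam_pos by (intro mult_mono) auto
  moreover have "rate (dc ?k) * self_similar j \<le> Max (\<rho> ` \<Omega>) * (f * lam * Max (\<rho> ` \<Omega>) ^ length j)"
    using * m r snoc.IH self_similar_pos[OF snoc(1)] by (intro mult_mono) auto
  ultimately show ?case
    using self_similar_offspring[OF snoc(1,2)] by (simp add: mult_ac)
qed

text \<open>Every node has an offspring with the largest rate, so always descending to such an
  offspring reaches the upper bound of \<open>self_similar_bounds\<close>.\<close>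

lemma self_similar_max_attained:
  "\<exists>j\<in>level d n. self_similar j = f * lam * Max (\<rho> ` \<Omega>) ^ n"
proof (induction n)
  case 0
  then show ?case by (simp add: level_0 self_similar_Nil)
next
  case (Suc n)
  then obtain j where j: "j \<in> level d n" "self_similar j = f * lam * Max (\<rho> ` \<Omega>) ^ n" by blast
  have jt: "j \<in> tree d" using j by (simp add: level_def)
  have "Max (\<rho> ` \<Omega>) \<in> \<rho> ` \<Omega>" using finite_\<Omega> \<Omega>_nonempty by (intro Max_in) auto
  then have "Max (\<rho> ` \<Omega>) \<in> (\<lambda>k. rate (dc k)) ` offspring d j"
    by (simp only: rate_dc_image_offspring[OF jt])
  then obtain k where k: "k \<in> offspring d j" "rate (dc k) = Max (\<rho> ` \<Omega>)"
    by (elim imageE) simp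
  then have "self_similar k = f * lam * Max (\<rho> ` \<Omega>) ^ Suc n"
    using self_similar_offspring[OF jt k(1)] j by simp
  then show ?case using k(1) j(1) level_Suc by blast
qed

lemma Max_\<rho>_pos: "Max (\<rho> ` \<Omega>) > 0"
  using finite_\<Omega> \<Omega>_nonempty \<rho>_pos by (auto simp: Max_gr_iff)

lemma Max_elog2_level:
  "Max ((\<lambda>j. elog2 \<bar>self_similar j\<bar>) ` level d n)
    = ereal (log 2 (f * lam) + real n * log 2 (Max (\<rho> ` \<Omega>)))"
proof (rule Max_eqI)
  have fl: "f * lam > 0" using f_pos lam_pos by simp
  have val: "log 2 (f * lam * Max (\<rho> ` \<Omega>) ^ n) = log 2 (f * lam) + real n * log 2 (Max (\<rho> ` \<Omega>))"
    using f_pos lam_pos Max_\<rho>_pos by (simp add: log_mult log_nat_power)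
  show "finite ((\<lambda>j. elog2 \<bar>self_similar j\<bar>) ` level d n)" by (simp add: finite_level)
  show "y \<le> ereal (log 2 (f * lam) + real n * log 2 (Max (\<rho> ` \<Omega>)))"
    if "y \<in> (\<lambda>j. elog2 \<bar>self_similar j\<bar>) ` level d n" for y
  proof -
    obtain j where j: "j \<in> tree d" "length j = n" "y = elog2 \<bar>self_similar j\<bar>"
      using \<open>y \<in> _\<close> unfolding level_def by blast
    have "self_similar j > 0" "self_similar j \<le> f * lam * Max (\<rho> ` \<Omega>) ^ n"
      using self_similar_pos self_similar_bounds j by auto
    then show ?thesis by (simp add: j elog2_def flip: val)
  qed
  obtain j where j: "j \<in> level d n" "self_similar j = f * lam * Max (\<rho> ` \<Omega>) ^ n"
    using self_similar_max_attained by blast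
  have "elog2 \<bar>self_similar j\<bar> = ereal (log 2 (self_similar j))"
    using self_similar_pos[OF level_in_tree[OF j(1)]] by (simp add: elog2_def)
  then have "elog2 \<bar>self_similar j\<bar> = ereal (log 2 (f * lam) + real n * log 2 (Max (\<rho> ` \<Omega>)))"
    by (simp only: j(2) val)
  then show "ereal (log 2 (f * lam) + real n * log 2 (Max (\<rho> ` \<Omega>)))
      \<in> (\<lambda>j. elog2 \<bar>self_similar j\<bar>) ` level d n"
    using j(1) by (metis imageI)
qed

text \<open>The maximum over level \<open>n\<close> is known exactly, so the expression under the
  supremum is affine in \<open>n\<close>. It is bounded above exactly when its slope
  \<open>c\<close> is not positive.\<close>

lemma self_similar_holder_iff:
  "self_similar \<in> holder_class d s \<longleftrightarrow> s + real d / 2 + log 2 (Max (\<rho> ` \<Omega>)) \<le> 0"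
proof -
  define c where "c = s + real d / 2 + log 2 (Max (\<rho> ` \<Omega>))"
  define a where "a = log 2 (f * lam)"
  have "self_similar \<in> holder_class d s \<longleftrightarrow> (SUP n \<in> {1::nat..}. ereal (a + real n * c)) < \<infinity>"
  proof -
    have "self_similar \<in> tree d \<rightarrow>\<^sub>E UNIV" by (simp add: self_similar_def)
    moreover have "ereal (real n * s + (1 / 2) * real d * real n)
        + Max ((\<lambda>j. elog2 \<bar>self_similar j\<bar>) ` level d n) = ereal (a + real n * c)" for n
      unfolding Max_elog2_level by (simp add: a_def c_def algebra_simps)
    ultimately show ?thesis unfolding holder_class_def by simp
  qed
  also have "\<dots> \<longleftrightarrow> c \<le> 0"
  proof
    assume "c \<le> 0"
    then have "(SUP n \<in> {1::nat..}. ereal (a + real n * c)) \<le> ereal a"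
      by (intro SUP_least) (auto simp: mult_nonneg_nonpos)
    then show "(SUP n \<in> {1::nat..}. ereal (a + real n * c)) < \<infinity>" by auto
  next
    assume "(SUP n \<in> {1::nat..}. ereal (a + real n * c)) < \<infinity>"
    then obtain B where B: "(SUP n \<in> {1::nat..}. ereal (a + real n * c)) \<le> ereal B"
      by (metis less_ereal.simps(2) ereal_cases less_PInf_Ex_of_nat order_less_imp_le)
    have *: "a + real n * c \<le> B" if "n \<ge> 1" for n
    proof -
      have "ereal (a + real n * c) \<le> ereal B"
        using B SUP_upper[of n "{1..}" "\<lambda>n. ereal (a + real n * c)"] that
        by (meson atLeast_iff order_trans)
      then show ?thesis by simp
    qed
    show "c \<le> 0"
    proof (rule ccontr)
      assume c: "\<not> c \<le> 0"
      then obtain n :: nat where "B - a < real n * c" using reals_Archimedean3[of c] by auto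
      \<comment> \<open>The Archimedean \<open>n\<close> may be 0, whereas the supremum starts at 1;
        hence the shift to \<open>Suc n\<close>.\<close>
      moreover have "real n * c \<le> real (Suc n) * c" using c by simp
      ultimately show False using *[of "Suc n"] by simp
    qed
  qed
  finally show ?thesis by (simp add: c_def)
qed

section \<open>Structure function and square summability\<close>

definition \<phi> :: "real \<Rightarrow> real" where
  "\<phi> p = real d - p / 2 * real d - log 2 (\<Sum>\<omega>\<in>\<Omega>. \<rho> \<omega> powr p)"

text \<open>Level sums of \<open>p\<close>-th powers are \<open>(f * lam) powr p * R ^ n\<close>.
  The prefactor disappears after taking logarithms and dividing by \<open>n\<close>, so the limsup
  is the limit \<open>log 2 R\<close>.\<close>

lemma structure_exponent_self_similar:
  "structure_exponent d self_similar p = ereal (min p (\<phi> p))"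
proof -
  define R where "R = (\<Sum>\<omega>\<in>\<Omega>. \<rho> \<omega> powr p)"
  have R: "R > 0" unfolding R_def by (rule sum_\<rho>_pos)
  have fl: "f * lam > 0" using f_pos lam_pos by simp
  have "(\<Sum>j\<in>level d n. \<bar>self_similar j\<bar> powr p) = (f * lam) powr p * R ^ n" for n
    unfolding R_def sum_level_self_similar[symmetric]
    using self_similar_pos[OF level_in_tree] by (intro sum.cong) (auto simp: abs_of_pos)
  then have e: "ereal (1 / real n) * elog2 (\<Sum>j\<in>level d n. \<bar>self_similar j\<bar> powr p)
      = ereal (1 / real n * (p * log 2 (f * lam) + real n * log 2 R))" for n
    using R fl f_pos lam_pos by (simp add: elog2_def log_mult log_powr log_nat_power)
  have "(\<lambda>n. p * log 2 (f * lam) * inverse (real n) + log 2 R)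
      \<longlonglongrightarrow> p * log 2 (f * lam) * 0 + log 2 R"
    by (intro tendsto_intros lim_inverse_n)
  then have "(\<lambda>n. p * log 2 (f * lam) * inverse (real n) + log 2 R) \<longlonglongrightarrow> log 2 R"
    unfolding mult_zero_right add_0 .
  then have "(\<lambda>n. 1 / real n * (p * log 2 (f * lam) + real n * log 2 R)) \<longlonglongrightarrow> log 2 R"
    \<comment> \<open>The two expressions agree only from \<open>n = 1\<close> on, since division by
      0 yields 0.\<close>
    by (rule Lim_transform_eventually) (auto simp: eventually_sequentially field_simps intro!: exI[of _ 1])
  then have "limsup (\<lambda>n. ereal (1 / real n) * elog2 (\<Sum>j\<in>level d n. \<bar>self_similar j\<bar> powr p))
      = ereal (log 2 R)"
    unfolding e by (intro lim_imp_Limsup) auto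
  then show ?thesis by (simp add: structure_exponent_def \<phi>_def R_def)
qed

text \<open>Squares summed over level \<open>n\<close> give a geometric sequence with ratio
  \<open>R < 1\<close>, and a finite set of nodes meets only finitely many levels.\<close>

lemma summable_self_similar:
  assumes r: "(\<Sum>\<omega>\<in>\<Omega>. \<rho> \<omega> powr 2) < 1"
  shows "(\<lambda>j. (self_similar j)\<^sup>2) summable_on tree d"
proof (rule nonneg_bdd_above_summable_on)
  define R where "R = (\<Sum>\<omega>\<in>\<Omega>. \<rho> \<omega> powr 2)"
  have R: "R > 0" "R < 1" unfolding R_def by (rule sum_\<rho>_pos, rule r)
  have lev: "(\<Sum>j\<in>level d n. (self_similar j)\<^sup>2) = (f * lam)\<^sup>2 * R ^ n" for n
  proof -
    have "(\<Sum>j\<in>level d n. (self_similar j)\<^sup>2) = (\<Sum>j\<in>level d n. self_similar j powr 2)"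
      using self_similar_pos[OF level_in_tree]
      by (intro sum.cong) (auto simp: powr_numeral less_imp_le)
    then show ?thesis
      using f_pos lam_pos by (simp add: sum_level_self_similar R_def powr_numeral less_imp_le)
  qed
  show "bdd_above (sum (\<lambda>j. (self_similar j)\<^sup>2) ` {F. F \<subseteq> tree d \<and> finite F})"
  proof (rule bdd_aboveI2)
    fix F assume F: "F \<in> {F. F \<subseteq> tree d \<and> finite F}"
    \<comment> \<open>The inserted 0 keeps the maximum meaningful for empty
      \<open>F\<close>.\<close>
    define m where "m = Suc (Max (insert 0 (length ` F)))"
    have "length j < m" if "j \<in> F" for j
      using that F by (auto simp: m_def less_Suc_eq_le intro!: Max_ge)
    then have sub: "F \<subseteq> (\<Union>n\<in>{..<m}. level d n)"
      using F by (auto simp: level_def)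
    have "(\<Sum>j\<in>F. (self_similar j)\<^sup>2) \<le> (\<Sum>j\<in>(\<Union>n\<in>{..<m}. level d n). (self_similar j)\<^sup>2)"
      using sub by (intro sum_mono2) (auto simp: finite_level)
    also have "\<dots> = (\<Sum>n<m. \<Sum>j\<in>level d n. (self_similar j)\<^sup>2)"
      by (intro sum.UNION_disjoint ballI finite_level) (auto simp: level_def)
    also have "\<dots> = (f * lam)\<^sup>2 * (\<Sum>n<m. R ^ n)"
      by (simp add: lev sum_distrib_left)
    also have "\<dots> \<le> (f * lam)\<^sup>2 * (\<Sum>n. R ^ n)"
      using R by (intro mult_left_mono sum_le_suminf summable_geometric) auto
    finally show "(\<Sum>j\<in>F. (self_similar j)\<^sup>2) \<le> (f * lam)\<^sup>2 * (\<Sum>n. R ^ n)" .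
  qed
qed simp

section \<open>Uniqueness of the Leray solution\<close>

text \<open>The right-hand side of the equation at \<open>j\<close> has \<open>v j\<close> as a
  factor, so a positive parent value forces \<open>v j \<noteq> 0\<close>. Positivity thus descends
  from \<open>f\<close>.\<close>

lemma constant_solution_pos:
  assumes "constant_solution d \<alpha> f dc v" "j \<in> tree d"
  shows "v j > 0"
  using assms(2)
proof -
  have nz: "v j > 0" if j: "j \<in> tree d" and p: "parent_val f v j > 0" for j
  proof -
    have "0 < coef \<alpha> dc j * (parent_val f v j)\<^sup>2" using coef_pos[OF j] p by simp
    also have "\<dots> = v j * (\<Sum>k\<in>offspring d j. coef \<alpha> dc k * v k)"
      using assms(1) j by (simp add: constant_solution_def sum_distrib_left mult_ac)
    finally have "v j \<noteq> 0" by auto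
    moreover have "v j \<ge> 0" using assms(1) j by (auto simp: constant_solution_def PiE_iff)
    ultimately show ?thesis by simp
  qed
  show ?thesis using assms(2)
  proof (induction rule: tree_induct)
    case Nil
    then show ?case using nz[OF Nil_in_tree] f_pos by (simp add: parent_val_def)
  next
    case (snoc j a)
    then show ?case using nz offspringD(1) parent_val_offspring by metis
  qed
qed

text \<open>Substituting \<open>v = self_similar * w\<close> and dividing by the balance of
  \<open>self_similar\<close> shows that \<open>m\<close> is the mean of \<open>w\<close> over the
  offspring with weights \<open>coef \<alpha> dc k * rate (dc k)\<close>. Both families have the
  same forcing, so the ratio above the root is 1.\<close>

lemma ratio_mean:
  assumes v: "constant_solution d \<alpha> f dc v" and j: "j \<in> tree d"
  defines "w \<equiv> \<lambda>j. v j / self_similar j"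
  defines "m \<equiv> (parent_val 1 w j)\<^sup>2 / w j"
  shows "\<exists>k\<in>offspring d j. w k \<le> m" "\<exists>k\<in>offspring d j. m \<le> w k"
proof -
  let ?u = "self_similar"
  let ?q = "\<lambda>k. coef \<alpha> dc k * rate (dc k)"
  have vw: "v i = ?u i * w i" if "i \<in> tree d" for i
    using self_similar_pos[OF that] by (simp add: w_def)
  have wj: "w j > 0" using constant_solution_pos[OF v j] self_similar_pos[OF j] by (simp add: w_def)
  have pv: "parent_val f v j = parent_val f ?u j * parent_val 1 w j"
    using j
  proof (cases rule: tree_cases)
    case (offspring i)
    then show ?thesis using vw by (simp add: parent_val_offspring)
  qed (simp add: parent_val_def)
  have "(\<Sum>k\<in>offspring d j. coef \<alpha> dc k * v j * v k)
      = (\<Sum>k\<in>offspring d j. (?u j)\<^sup>2 * (w j * (?q k * w k)))"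
    using j offspringD(1)
    by (intro sum.cong) (auto simp: vw self_similar_offspring power2_eq_square)
  then have "coef \<alpha> dc j * (parent_val f v j)\<^sup>2
      = (?u j)\<^sup>2 * (w j * (\<Sum>k\<in>offspring d j. ?q k * w k))"
    using v j by (simp add: constant_solution_def sum_distrib_left)
  moreover have "coef \<alpha> dc j * (parent_val f v j)\<^sup>2
      = (?u j)\<^sup>2 * ((parent_val 1 w j)\<^sup>2 * sum ?q (offspring d j))"
    using self_similar_balance[OF j] by (simp add: pv power_mult_distrib mult_ac)
  ultimately have "(parent_val 1 w j)\<^sup>2 * sum ?q (offspring d j)
      = w j * (\<Sum>k\<in>offspring d j. ?q k * w k)"
    using self_similar_pos[OF j] by simp
  then have eq: "m * sum ?q (offspring d j) = (\<Sum>k\<in>offspring d j. ?q k * w k)"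
    using wj by (simp add: m_def field_simps)
  have q: "?q k > 0" if "k \<in> offspring d j" for k
    using coef_pos rate_pos dc_pos offspringD(1)[OF that] by simp
  show "\<exists>k\<in>offspring d j. w k \<le> m" "\<exists>k\<in>offspring d j. m \<le> w k"
    using weighted_mean_bounds[OF finite_offspring[OF j] offspring_nonempty[OF j] q eq] by blast+
qed

text \<open>Two generations cube the ratio. If \<open>w k = x \<ge> 1\<close> and the parent ratio
  is at most 1, some offspring \<open>l\<close> has ratio at most \<open>1 / x\<close>, and then
  some offspring \<open>r\<close> of \<open>l\<close> has ratio at least
  \<open>x ^ 2 / (1 / x) = x ^ 3\<close>. Since \<open>1 / x \<le> 1\<close>, the condition on the
  parent ratio holds again at \<open>r\<close>.\<close>

lemma ratio_growth:
  assumes v: "constant_solution d \<alpha> f dc v" and j: "j \<in> tree d"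
  defines "w \<equiv> \<lambda>j. v j / self_similar j"
  assumes "parent_val 1 w j \<le> 1" "w j \<ge> b" "b > 1"
  shows "\<exists>k\<in>tree d. length k = length j + 2 * m \<and> parent_val 1 w k \<le> 1 \<and> w k \<ge> b ^ 3 ^ m"
proof (induction m)
  case 0
  then show ?case using assms by auto
next
  case (Suc m)
  then obtain k where k: "k \<in> tree d" "length k = length j + 2 * m" "parent_val 1 w k \<le> 1"
      "w k \<ge> b ^ 3 ^ m" by blast
  have wpos: "w i > 0" if "i \<in> tree d" for i
    using constant_solution_pos[OF v that] self_similar_pos[OF that] by (simp add: w_def)
  \<comment> \<open>Nonnegativity is needed to square the bound on the parent ratio.\<close>
  have pw: "parent_val 1 w k \<ge> 0"
    using k(1)
  proof (cases rule: tree_cases)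
    case (offspring i)
    then show ?thesis using wpos[of i] by (simp add: parent_val_offspring)
  qed (simp add: parent_val_def)
  have wk: "w k \<ge> 1" using k(4) \<open>b > 1\<close> by (meson less_imp_le one_le_power order_trans)
  obtain l where l: "l \<in> offspring d k" "w l \<le> (parent_val 1 w k)\<^sup>2 / w k"
    using ratio_mean(1)[OF v k(1)] unfolding w_def by blast
  have lt: "l \<in> tree d" using offspringD(1)[OF l(1)] .
  have "(parent_val 1 w k)\<^sup>2 \<le> 1" using pw k(3) by (simp add: power_le_one)
  then have wl: "w l \<le> 1 / w k" using l(2) wk by (smt (verit) divide_right_mono)
  obtain r where r: "r \<in> offspring d l" "(parent_val 1 w l)\<^sup>2 / w l \<le> w r"
    using ratio_mean(2)[OF v lt] unfolding w_def by blast
  have "w k ^ 3 = (w k)\<^sup>2 / (1 / w k)" by (simp add: power2_eq_square power3_eq_cube)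
  also have "\<dots> \<le> (w k)\<^sup>2 / w l" using wl wpos[OF lt] wk by (intro divide_left_mono) auto
  also have "\<dots> \<le> w r" using r(2) parent_val_offspring[OF l(1)] by metis
  finally have "w k ^ 3 \<le> w r" .
  moreover have "b ^ 3 ^ Suc m \<le> w k ^ 3"
  proof -
    have "b ^ 3 ^ Suc m = (b ^ 3 ^ m) ^ 3" by (simp add: mult.commute flip: power_mult)
    then show ?thesis using k(4) \<open>b > 1\<close> by (simp add: power_mono)
  qed
  moreover have "parent_val 1 w r \<le> 1"
    using wl wk parent_val_offspring[OF r(1), of 1 w]
    by (smt (verit) divide_le_eq_1)
  moreover have "length r = length j + 2 * Suc m"
    using offspringD(4)[OF r(1)] offspringD(4)[OF l(1)] k(2) by simp
  ultimately show ?case using offspringD(1)[OF r(1)] by (intro bexI[of _ r]) auto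
qed

text \<open>A ratio above 1 under a parent ratio at most 1 triggers \<open>ratio_growth\<close>,
  which contradicts boundedness of \<open>v\<close>. A ratio below 1 under parent ratio 1 produces
  an offspring with ratio above 1, and the same argument applies there.\<close>

lemma Leray_ratio_eq_1:
  assumes v: "constant_Leray_solution d \<alpha> f dc v" and j: "j \<in> tree d"
  defines "w \<equiv> \<lambda>j. v j / self_similar j"
  assumes par: "parent_val 1 w j = 1"
  shows "w j = 1"
proof -
  have cs: "constant_solution d \<alpha> f dc v" and sm: "(\<lambda>j. (v j)\<^sup>2) summable_on tree d"
    using v by (auto simp: constant_Leray_solution_def)
  define K where "K = (\<Sum>\<^sub>\<infinity>j\<in>tree d. (v j)\<^sup>2)"
  \<comment> \<open>Square summability enters as a uniform bound on the values.\<close>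
  have K: "v i \<le> K + 1" if "i \<in> tree d" for i
  proof -
    have "(v i)\<^sup>2 \<le> K"
      using finite_sum_le_infsum[OF sm, of "{i}"] that by (simp add: K_def)
    moreover have "v i \<le> (v i)\<^sup>2 + 1"
      using sum_squares_ge_zero[of "v i - 1" "v i"] zero_le_power2[of "v i - 1"]
      by (simp add: power2_eq_square algebra_simps)
    ultimately show ?thesis by linarith
  qed
  have no: False if i: "i \<in> tree d" "parent_val 1 w i \<le> 1" "w i > 1" for i
  proof -
    define b where "b = w i"
    define r where "r = Min (\<rho> ` \<Omega>)"
    define C where "C = f * lam * r ^ length i"
    have r: "r > 0" using finite_\<Omega> \<Omega>_nonempty \<rho>_pos by (auto simp: r_def)
    have C: "C > 0" using r f_pos lam_pos by (simp add: C_def)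
    have b: "b > 1" using i by (simp add: b_def)
    \<comment> \<open>Each cubing descends two generations, which costs at most the factor
      \<open>r ^ 2\<close>; \<open>C\<close> bounds \<open>self_similar i\<close> from
      below.\<close>
    have le: "C * r ^ (2 * m) * b ^ 3 ^ m \<le> K + 1" for m
    proof -
      obtain k where k: "k \<in> tree d" "length k = length i + 2 * m" "w k \<ge> b ^ 3 ^ m"
        using ratio_growth[OF cs i(1), of b m] i b unfolding w_def b_def by auto
      have "C * r ^ (2 * m) \<le> self_similar k"
        using self_similar_bounds[OF k(1)] by (simp add: C_def r_def k(2) power_add mult_ac)
      then have "C * r ^ (2 * m) * b ^ 3 ^ m \<le> self_similar k * w k"
        using k(3) b C r self_similar_pos[OF k(1)] by (intro mult_mono) auto
      also have "\<dots> = v k" using self_similar_pos[OF k(1)] by (simp add: w_def)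
      finally show ?thesis using K[OF k(1)] by linarith
    qed
    have "ln b > 0" using b by simp
    then have "filterlim (\<lambda>m::nat. C * exp (ln r * (2 * real m) + ln b * 3 ^ m)) at_top sequentially"
      using C by real_asymp
    \<comment> \<open>The term \<open>3 ^ m\<close> beats the linear exponent whatever the sign of
      \<open>ln r\<close>, and \<open>K + 2\<close> strictly exceeds the bound
      \<open>K + 1\<close>.\<close>
    then have "\<forall>\<^sub>F m in sequentially. K + 2 \<le> C * exp (ln r * (2 * real m) + ln b * 3 ^ m)"
      by (simp add: filterlim_at_top)
    then obtain m where m: "K + 2 \<le> C * exp (ln r * (2 * real m) + ln b * 3 ^ m)"
      by (auto simp: eventually_sequentially)
    have "exp (ln r * (2 * real m)) = r ^ (2 * m)"
      using r exp_of_nat_mult[of "2 * m" "ln r"] by (simp add: mult.commute)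
    moreover have "exp (ln b * 3 ^ m) = b ^ 3 ^ m"
      using b exp_of_nat_mult[of "3 ^ m" "ln b"] by (simp add: mult.commute)
    ultimately show False using m le[of m] by (simp add: exp_add)
  qed
  show ?thesis
  proof (rule ccontr)
    assume ne: "w j \<noteq> 1"
    show False
    proof (cases "w j > 1")
      case True
      then show False using no[OF j] par by simp
    next
      case False
      then have lt: "w j < 1" using ne by simp
      have pos: "w j > 0"
        using constant_solution_pos[OF cs j] self_similar_pos[OF j] by (simp add: w_def)
      obtain k where k: "k \<in> offspring d j" "(parent_val 1 w j)\<^sup>2 / w j \<le> w k"
        using ratio_mean(2)[OF cs j] unfolding w_def by blast
      then have "w k > 1" using par lt pos by (smt (verit) less_divide_eq_1_pos power_one)
      then show False
        using no[OF offspringD(1)[OF k(1)]] lt parent_val_offspring[OF k(1), of 1 w] by simp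
    qed
  qed
qed

lemma Leray_solution_unique:
  assumes v: "constant_Leray_solution d \<alpha> f dc v"
  shows "v = self_similar"
proof
  fix j
  define w where "w = (\<lambda>j. v j / self_similar j)"
  show "v j = self_similar j"
  proof (cases "j \<in> tree d")
    case True
    then have "w j = 1"
    proof (induction rule: tree_induct)
      case Nil
      then show ?case
        using Leray_ratio_eq_1[OF v Nil_in_tree] by (simp add: w_def parent_val_def)
    next
      case (snoc j a)
      then show ?case
        using Leray_ratio_eq_1[OF v offspringD(1)[OF snoc(2)]] parent_val_offspring[OF snoc(2), of 1 w]
        by (simp add: w_def)
    qed
    then show ?thesis using self_similar_pos[OF True] by (simp add: w_def)
  next
    \<comment> \<open>Off the tree both families are \<open>undefined\<close> by
      extensionality.\<close>
    case False
    then show ?thesis using v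
      by (auto simp: constant_Leray_solution_def constant_solution_def self_similar_def PiE_iff
          extensional_def)
  qed
qed

section \<open>Exponents expressed through \<open>ell\<close>, and the shape of
  \<open>\<phi>\<close>\<close>

lemma log_lam: "log 2 lam = - (\<alpha> + log 2 S) / 3"
  using S_pos by (simp add: lam_def log_powr log_mult field_simps)

lemma log_sum_\<rho>:
  "log 2 (\<Sum>\<omega>\<in>\<Omega>. \<rho> \<omega> powr p) = p * log 2 lam + log 2 (\<Sum>\<omega>\<in>\<Omega>. \<delta> \<omega> powr (p / 2))"
proof -
  have "(\<Sum>\<omega>\<in>\<Omega>. \<rho> \<omega> powr p) = lam powr p * (\<Sum>\<omega>\<in>\<Omega>. \<delta> \<omega> powr (p / 2))"
    unfolding sum_distrib_left using lam_pos \<delta>_pos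
    by (intro sum.cong) (auto simp: rate_def powr_mult powr_powr less_imp_le)
  moreover have "(\<Sum>\<omega>\<in>\<Omega>. \<delta> \<omega> powr (p / 2)) > 0"
    using finite_\<Omega> \<Omega>_nonempty \<delta>_pos by (intro sum_pos) (auto simp: less_imp_neq[symmetric])
  ultimately show ?thesis using lam_pos by (simp add: log_mult log_powr)
qed

lemma ell_eq:
  assumes "s \<noteq> 0"
  shows "s * ell \<Omega> \<delta> s = log 2 (\<Sum>\<omega>\<in>\<Omega>. \<delta> \<omega> powr s) - real d"
proof -
  have "(\<Sum>\<omega>\<in>\<Omega>. \<delta> \<omega> powr s) > 0"
    using finite_\<Omega> \<Omega>_nonempty \<delta>_pos by (intro sum_pos) (auto simp: less_imp_neq[symmetric])
  then show ?thesis using assms by (simp add: ell_def card_\<Omega> log_divide log_nat_power)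
qed

lemma \<phi>_0: "\<phi> 0 = 0"
proof -
  have "(\<Sum>\<omega>\<in>\<Omega>. \<rho> \<omega> powr 0) = (\<Sum>\<omega>\<in>\<Omega>. 1)"
    using \<rho>_pos by (intro sum.cong) (auto simp: less_imp_neq[symmetric])
  then show ?thesis by (simp add: \<phi>_def card_\<Omega> log_nat_power)
qed

lemma \<phi>_eq:
  "\<phi> p = p / 3 * (\<alpha> - real d / 2) + p / 2 * (ell \<Omega> \<delta> (3 / 2) - ell \<Omega> \<delta> (p / 2))"
\<comment> \<open>\<open>ell_eq\<close> excludes exponent 0; for \<open>p = 0\<close> the right-hand
  side vanishes through its factors \<open>p\<close>, the left-hand side by
  \<open>\<phi>_0\<close>.\<close>
proof (cases "p = 0")
  case False
  have "3 / 2 * ell \<Omega> \<delta> (3 / 2) = log 2 S - real d"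
    using ell_eq[of "3 / 2"] by (simp add: S_def)
  then have "ell \<Omega> \<delta> (3 / 2) = 2 / 3 * (log 2 S - real d)" by simp
  moreover have "p / 2 * ell \<Omega> \<delta> (p / 2) = log 2 (\<Sum>\<omega>\<in>\<Omega>. \<delta> \<omega> powr (p / 2)) - real d"
    using ell_eq[of "p / 2"] False by simp
  ultimately show ?thesis
    by (simp add: \<phi>_def log_sum_\<rho> log_lam right_diff_distrib) (simp add: field_simps)
qed (simp add: \<phi>_0)

lemma rate_Max: "rate (Max (\<delta> ` \<Omega>)) = Max (\<rho> ` \<Omega>)"
proof -
  have "Max (\<delta> ` \<Omega>) \<in> \<delta> ` \<Omega>" using finite_\<Omega> \<Omega>_nonempty by (intro Max_in) auto
  then obtain w0 where w0: "w0 \<in> \<Omega>" "Max (\<delta> ` \<Omega>) = \<delta> w0" by auto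
  have "\<delta> w \<le> \<delta> w0" if "w \<in> \<Omega>" for w
    unfolding w0(2)[symmetric] using that finite_\<Omega> by simp
  then have "rate (\<delta> w) \<le> rate (\<delta> w0)" if "w \<in> \<Omega>" for w
    using that w0 rate_less_iff \<delta>_pos by (meson not_le)
  then show ?thesis unfolding w0 using w0 finite_\<Omega> by (intro Max_eqI[symmetric]) auto
qed

text \<open>The bracket is the number \<open>h\<close> of the theorem, so the largest rate is
  \<open>2 powr (- real d / 2 - h)\<close>. This ties \<open>h\<close> to the Hoelder exponent and
  to the slope of the asymptote.\<close>

lemma log_Max_\<rho>:
  "log 2 (Max (\<rho> ` \<Omega>))
    = - real d / 2 - ((1 / 3) * (\<alpha> - real d / 2) - (1 / 2) * (ell_inf \<Omega> \<delta> - ell \<Omega> \<delta> (3 / 2)))"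
proof -
  have "Max (\<delta> ` \<Omega>) > 0" using finite_\<Omega> \<Omega>_nonempty \<delta>_pos by (auto simp: Max_gr_iff)
  then have "log 2 (Max (\<rho> ` \<Omega>)) = log 2 lam + ell_inf \<Omega> \<delta> / 2"
    unfolding rate_Max[symmetric] using lam_pos
    by (simp add: rate_def log_mult log_powr ell_inf_def)
  moreover have "3 / 2 * ell \<Omega> \<delta> (3 / 2) = log 2 S - real d"
    using ell_eq[of "3 / 2"] by (simp add: S_def)
  ultimately show ?thesis by (simp add: log_lam field_simps)
qed

text \<open>\<open>rate\<close> is strictly increasing on positive numbers, so the maximisers and
  their multiplicity are preserved.\<close>

lemma card_Max_\<rho>: "{\<omega> \<in> \<Omega>. \<rho> \<omega> = Max (\<rho> ` \<Omega>)} = {\<omega> \<in> \<Omega>. \<delta> \<omega> = Max (\<delta> ` \<Omega>)}"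
proof -
  have "Max (\<delta> ` \<Omega>) > 0" using finite_\<Omega> \<Omega>_nonempty \<delta>_pos by (auto simp: Max_gr_iff)
  then have "\<rho> \<omega> = rate (Max (\<delta> ` \<Omega>)) \<longleftrightarrow> \<delta> \<omega> = Max (\<delta> ` \<Omega>)" if "\<omega> \<in> \<Omega>" for \<omega>
    using rate_less_iff \<delta>_pos[OF that] by (metis less_irrefl not_less_iff_gr_or_eq)
  then show ?thesis by (auto simp: rate_Max)
qed

lemma concave_\<phi>: "concave_on UNIV \<phi>"
proof -
  have "convex_on UNIV (\<lambda>p. log 2 (\<Sum>\<omega>\<in>\<Omega>. \<rho> \<omega> powr p))"
    using convex_on_log_sum_powr[of \<Omega> \<rho>] finite_\<Omega> \<Omega>_nonempty \<rho>_pos by blast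
  moreover have "concave_on UNIV (\<lambda>p. real d - p / 2 * real d)"
  proof -
    have "u * (real d - x / 2 * real d) + v * (real d - y / 2 * real d)
        = (u + v) * real d - (u * x + v * y) / 2 * real d" for u v x y :: real
      by (simp add: field_simps)
    then show ?thesis unfolding concave_on_iff by simp
  qed
  ultimately have "concave_on UNIV (\<lambda>p. (real d - p / 2 * real d) - log 2 (\<Sum>\<omega>\<in>\<Omega>. \<rho> \<omega> powr p))"
    by (rule concave_on_diff[rotated])
  then show ?thesis unfolding \<phi>_def by simp
qed

lemma continuous_\<phi>: "continuous_on A \<phi>"
proof -
  have "\<rho> \<omega> \<noteq> 0" if "\<omega> \<in> \<Omega>" for \<omega> using \<rho>_pos[OF that] by simp
  moreover have "(\<Sum>\<omega>\<in>\<Omega>. \<rho> \<omega> powr p) \<noteq> 0" "(\<Sum>\<omega>\<in>\<Omega>. \<rho> \<omega> powr p) > 0" for p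
    using sum_\<rho>_pos[of p] by auto
  ultimately show ?thesis
    unfolding \<phi>_def by (intro continuous_intros) auto
qed

text \<open>Absorbing the linear term into the bases lets monotonicity be read off termwise: bases
  at most 1 have powers non-increasing in \<open>p\<close>.\<close>

lemma \<phi>_scaled: "\<phi> p = real d - log 2 (\<Sum>\<omega>\<in>\<Omega>. (2 powr (real d / 2) * \<rho> \<omega>) powr p)"
proof -
  have "(\<Sum>\<omega>\<in>\<Omega>. (2 powr (real d / 2) * \<rho> \<omega>) powr p) = 2 powr (p / 2 * real d) * (\<Sum>\<omega>\<in>\<Omega>. \<rho> \<omega> powr p)"
    unfolding sum_distrib_left using \<rho>_pos
    by (intro sum.cong) (auto simp: powr_mult powr_powr less_imp_le mult.commute)
  then show ?thesis using sum_\<rho>_pos[of p] by (simp add: \<phi>_def log_mult)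
qed

lemma \<phi>_mono:
  assumes "\<And>\<omega>. \<omega> \<in> \<Omega> \<Longrightarrow> 2 powr (real d / 2) * \<rho> \<omega> \<le> 1" and "p \<le> q"
  shows "\<phi> p \<le> \<phi> q"
proof -
  have "(\<Sum>\<omega>\<in>\<Omega>. (2 powr (real d / 2) * \<rho> \<omega>) powr q) \<le> (\<Sum>\<omega>\<in>\<Omega>. (2 powr (real d / 2) * \<rho> \<omega>) powr p)"
    using assms \<rho>_pos by (intro sum_mono powr_mono') (auto simp: less_imp_le)
  moreover have "(\<Sum>\<omega>\<in>\<Omega>. (2 powr (real d / 2) * \<rho> \<omega>) powr q) > 0"
    using finite_\<Omega> \<Omega>_nonempty \<rho>_pos by (intro sum_pos) (auto simp: less_imp_neq[symmetric])
  ultimately show ?thesis unfolding \<phi>_scaled by (simp add: log_le_cancel_iff)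
qed

lemma \<phi>_asymptote:
  "((\<lambda>p. \<phi> p - (- (real d / 2 + log 2 (Max (\<rho> ` \<Omega>))) * p + real d
      - log 2 (real (card {\<omega> \<in> \<Omega>. \<delta> \<omega> = Max (\<delta> ` \<Omega>)})))) \<longlongrightarrow> 0) at_top"
proof -
  have "((\<lambda>p. log 2 (\<Sum>\<omega>\<in>\<Omega>. \<rho> \<omega> powr p) - p * log 2 (Max (\<rho> ` \<Omega>)))
      \<longlongrightarrow> log 2 (real (card {\<omega> \<in> \<Omega>. \<delta> \<omega> = Max (\<delta> ` \<Omega>)}))) at_top" (is "(?g \<longlongrightarrow> ?L) _")
    using log_sum_powr_asymptote[of \<Omega> \<rho>] finite_\<Omega> \<Omega>_nonempty \<rho>_pos card_Max_\<rho> by simp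
  then have "((\<lambda>p. ?L - ?g p) \<longlongrightarrow> ?L - ?L) at_top" by (intro tendsto_intros)
  then show ?thesis by (simp add: \<phi>_def algebra_simps)
qed

end

section \<open>Existence, uniqueness and regularity for \<open>0 < h < 1\<close>\<close>

theorem theorem4p1:
  fixes d :: nat and \<alpha> f h :: real and dc :: "nat list \<Rightarrow> real"
    and \<Omega> :: "'w set" and \<delta> :: "'w \<Rightarrow> real"
  assumes "d \<ge> 1" and "\<alpha> > 0" and "f > 0"
    and "\<forall>j \<in> tree d. dc j > 0" and "dc [] = 1"
    and "repeated_coefficients d dc \<Omega> \<delta>"
    and "h = (1 / 3) * (\<alpha> - real d / 2) - (1 / 2) * (ell_inf \<Omega> \<delta> - ell \<Omega> \<delta> (3 / 2))"
    and "0 < h" and "h < 1"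
  shows "(\<exists>!u. constant_Leray_solution d \<alpha> f dc u) \<and>
    (\<forall>u. constant_Leray_solution d \<alpha> f dc u \<longrightarrow>
       (\<forall>s. 0 < s \<and> s < 1 \<longrightarrow> (u \<in> holder_class d s \<longleftrightarrow> s \<le> h)) \<and>
       (\<forall>p \<ge> 0. structure_exponent d u p =
          ereal (min p (p / 3 * (\<alpha> - real d / 2)
                        + p / 2 * (ell \<Omega> \<delta> (3 / 2) - ell \<Omega> \<delta> (p / 2))))) \<and>
       (let \<zeta> = (\<lambda>p. real_of_ereal (structure_exponent d u p)) in
          continuous_on {0..} \<zeta> \<and> mono_on {0..} \<zeta> \<and> concave_on {0..} \<zeta> \<and>
          \<zeta> 0 = 0 \<and> \<zeta> 3 = min 3 (\<alpha> - real d / 2) \<and>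
          ((\<lambda>p. \<zeta> p - (h * p + real d
              - log 2 (real (card {\<omega> \<in> \<Omega>. \<delta> \<omega> = Max (\<delta> ` \<Omega>)})))) \<longlongrightarrow> 0) at_top))"
proof -
  interpret rcm d \<alpha> f dc \<Omega> \<delta>
    using assms by unfold_locales auto
  have h: "log 2 (Max (\<rho> ` \<Omega>)) = - real d / 2 - h"
    unfolding log_Max_\<rho> assms(7) by simp
  \<comment> \<open>The largest of these scaled rates is \<open>2 powr (- h)\<close>, so
    \<open>h > 0\<close> yields both monotonicity of \<open>\<phi>\<close> and square
    summability.\<close>
  have scaled: "2 powr (real d / 2) * \<rho> \<omega> < 1" if w: "\<omega> \<in> \<Omega>" for \<omega>
  proof -
    have "log 2 (\<rho> \<omega>) \<le> log 2 (Max (\<rho> ` \<Omega>))"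
      using w finite_\<Omega> \<rho>_pos[OF w] Max_\<rho>_pos by simp
    then have "log 2 (2 powr (real d / 2) * \<rho> \<omega>) < 0"
      using \<rho>_pos[OF w] assms(8) h by (simp add: log_mult)
    then show ?thesis using \<rho>_pos[OF w] by (simp add: log_less_zero_cancel_iff)
  qed
  have mono: "p \<le> q \<Longrightarrow> \<phi> p \<le> \<phi> q" for p q
    using \<phi>_mono scaled by (simp add: less_imp_le)
  \<comment> \<open>Each of the \<open>2 ^ d\<close> squared rates is below
    \<open>2 powr (- real d)\<close>, so the geometric ratio of the level sums is below 1.\<close>
  have "(\<Sum>\<omega>\<in>\<Omega>. \<rho> \<omega> powr 2) < (\<Sum>\<omega>\<in>\<Omega>. 2 powr (- real d))"
  proof (rule sum_strict_mono)
    fix \<omega> assume w: "\<omega> \<in> \<Omega>"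
    have "\<rho> \<omega> < 2 powr (- (real d / 2))"
      using scaled[OF w] by (simp add: powr_minus field_simps)
    then have "\<rho> \<omega> powr 2 < (2 powr (- (real d / 2))) powr 2"
      using \<rho>_pos[OF w] by (intro powr_less_mono2) auto
    then show "\<rho> \<omega> powr 2 < 2 powr (- real d)" by (simp add: powr_powr)
  qed (use finite_\<Omega> \<Omega>_nonempty in auto)
  also have "\<dots> = 1" by (simp add: card_\<Omega> powr_minus powr_realpow)
  finally have "constant_Leray_solution d \<alpha> f dc self_similar"
    by (simp add: constant_Leray_solution_def constant_solution_self_similar summable_self_similar)
  then have ex1: "\<exists>!u. constant_Leray_solution d \<alpha> f dc u"
    using Leray_solution_unique by (intro ex1I) auto
  define \<zeta> where "\<zeta> = (\<lambda>p. min p (\<phi> p))"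
  define L where "L = log 2 (real (card {\<omega> \<in> \<Omega>. \<delta> \<omega> = Max (\<delta> ` \<Omega>)}))"
  have \<zeta>: "(\<lambda>p. real_of_ereal (structure_exponent d self_similar p)) = \<zeta>"
    by (simp add: structure_exponent_self_similar \<zeta>_def del: ereal_min)
  have holder: "self_similar \<in> holder_class d s \<longleftrightarrow> s \<le> h" for s
    by (simp add: self_similar_holder_iff h)
  have cont: "continuous_on {0..} \<zeta>"
    unfolding \<zeta>_def by (intro continuous_intros continuous_\<phi>)
  have mon: "mono_on {0..} \<zeta>"
    unfolding \<zeta>_def using mono by (auto intro!: mono_onI simp: min_le_iff_disj)
  have conc: "concave_on {0..} \<zeta>"
    unfolding \<zeta>_def
    by (intro concave_on_min) (use concave_\<phi> in \<open>auto simp: concave_on_iff\<close>)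
  \<comment> \<open>At \<open>p = 3\<close> the two \<open>ell\<close> terms coincide and
    cancel.\<close>
  have \<zeta>3: "\<zeta> 3 = min 3 (\<alpha> - real d / 2)" by (simp add: \<zeta>_def \<phi>_eq add_divide_distrib diff_divide_distrib)
  have lim: "((\<lambda>p. \<phi> p - (h * p + real d - L)) \<longlongrightarrow> 0) at_top"
    using \<phi>_asymptote by (simp add: h L_def)
  have asy: "((\<lambda>p. \<zeta> p - (h * p + real d - L)) \<longlongrightarrow> 0) at_top"
  \<comment> \<open>As \<open>h < 1\<close>, the asymptote eventually lies at least 1 below
    \<open>p\<close>, while \<open>\<phi> p\<close> exceeds it by less than 1; the minimum is then
    \<open>\<phi> p\<close>.\<close>
  proof (rule Lim_transform_eventually[OF lim])
    have "\<forall>\<^sub>F p in at_top. \<phi> p - (h * p + real d - L) < 1"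
      using order_tendstoD(2)[OF lim, of 1] by simp
    moreover have "\<forall>\<^sub>F p in at_top. h * p + real d - L + 1 \<le> p"
      using assms(9) by real_asymp
    ultimately show "\<forall>\<^sub>F p in at_top. \<phi> p - (h * p + real d - L) = \<zeta> p - (h * p + real d - L)"
      by eventually_elim (simp add: \<zeta>_def)
  qed
  show ?thesis
  proof (intro conjI ex1 allI impI)
    fix u assume "constant_Leray_solution d \<alpha> f dc u"
    then have u: "u = self_similar" by (rule Leray_solution_unique)
    show "u \<in> holder_class d s \<longleftrightarrow> s \<le> h" for s by (simp add: u holder)
    show "structure_exponent d u p = ereal (min p (p / 3 * (\<alpha> - real d / 2)
        + p / 2 * (ell \<Omega> \<delta> (3 / 2) - ell \<Omega> \<delta> (p / 2))))" for p
      unfolding u structure_exponent_self_similar \<phi>_eq ..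
    show "let \<zeta> = (\<lambda>p. real_of_ereal (structure_exponent d u p)) in
          continuous_on {0..} \<zeta> \<and> mono_on {0..} \<zeta> \<and> concave_on {0..} \<zeta> \<and>
          \<zeta> 0 = 0 \<and> \<zeta> 3 = min 3 (\<alpha> - real d / 2) \<and>
          ((\<lambda>p. \<zeta> p - (h * p + real d
              - log 2 (real (card {\<omega> \<in> \<Omega>. \<delta> \<omega> = Max (\<delta> ` \<Omega>)})))) \<longlongrightarrow> 0) at_top"
      unfolding u \<zeta> Let_def using cont mon conc \<zeta>3 asy by (simp add: L_def) (simp add: \<zeta>_def \<phi>_0)
  qed
qed

end
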